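(* Let $H=(H_1,\ldots,H_n,p_1,\ldots,p_n)$ be a strategic game, and let $br^g_i$ and $sd^l_i$ be the global best response property (with beliefs being joint pure strategies of the opponents) and the local strict dominance property of player $i$. Then: (i) for all belief models for $H$, $$G_{\mathbf{RAT}(br^g)\cap B^*\mathbf{RAT}(br^g)}\subseteq T^{\infty}_{sd^l};$$ (ii) for all knowledge models for $H$, $$G_{K^*\mathbf{RAT}(br^g)}\subseteq T^{\infty}_{sd^l}.$$
   Context: A strategic game $H=(H_1,\ldots,H_n,p_1,\ldots,p_n)$ ($n>1$) consists of non-empty strategy sets $H_i$ (arbitrary, possibly infinite) and payoff functions $p_i:H_1\times\cdots\times H_n\to\mathbb{R}$. A restriction of $H$ is a tuple $G=(G_1,\ldots,G_n)$ with $G_i\subseteq H_i$; restrictions are ordered by componentwise inclusion $\subseteq$; the largest one $(H_1,\ldots,H_n)$ is identified with $H$. $G_{-i}:=\prod_{j\ne i}G_j$. Properties, for $s_i\in H_i$ and a restriction $G$: - $br^g_i(s_i,G)$ holds iff there is $s_{-i}\in G_{-i}$ such that $p_i(s_i,s_{-i})\ge p_i(s_i',s_{-i})$ for all $s_i'\in H_i$. - $sd^l_i(s_i,G)$ holds iff there is no $s_i'\in G_i$ such that $p_i(s_i',s_{-i})>p_i(s_i,s_{-i})$ for all $s_{-i}\in G_{-i}$. For a family $\phi=(\phi_1,\ldots,\phi_n)$ of properties the operator $T_\phi$ on restrictions is $T_\phi(G)=(G_1',\ldots,G_n')$ with $G_i'=\{s_i\in G_i\mid \phi_i(s_i,G)\}$.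 Put $T^0=H$, $T^{\alpha+1}=T(T^\alpha)$, $T^\beta=\bigcap_{\alpha<\beta}T^\alpha$ for limit ordinals $\beta$; $T^\infty:=T^{\alpha}$ for the least $\alpha$ with $T^{\alpha+1}=T^\alpha$ (it exists since $T_\phi(G)\subseteq G$). A belief model for $H$ is $(\Omega,\overline{s_1},\ldots,\overline{s_n},P_1,\ldots,P_n)$ where $\Omega$ is a non-empty set of states, $\overline{s_i}:\Omega\to H_i$, and each $P_i:\Omega\to\mathcal{P}(\Omega)$ satisfies: (1) $P_i(\omega)\neq\emptyset$ for all $\omega$; (2) $\omega'\in P_i(\omega)$ implies $P_i(\omega')=P_i(\omega)$. It is a knowledge model if moreover $\omega\in P_i(\omega)$ for all $\omega$ and $i$. For an event $E\subseteq\Omega$: $\square E=\{\omega\mid \forall i\ P_i(\omega)\subseteq E\}$, $\square^1E=\square E$, $\square^{k+1}E=\square\square^kE$, $\square^*E=\bigcap_{k\ge1}\square^kE$. One writes $B^*$ for $\square^*$ in belief models and $K^*$ for $\square^*$ in knowledge models. For $E\subseteq\Omega$, $G_E:=(\overline{s_1}(E),\ldots,\overline{s_n}(E))$. $\mathbf{RAT}(\phi):=\{\omega\in\Omega\mid \phi_i(\overline{s_i}(\omega),G_{P_i(\omega)})\text{ holds for all } i\in\{1,\ldots,n\}\}$. *)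

theory Defs
  imports Complex_Main "HOL-Library.FuncSet" "HOL-Library.Cardinality"
begin

unbundle cardinal_syntax

text \<open>
  Players are the elements of a finite type \<open>'i\<close>, and all strategies live in one type \<open>'s\<close>;
  the strategy set of player \<open>i\<close> is a subset of \<open>'s\<close>. No generality is lost, since finitely many
  sets embed into their disjoint union. A restriction is a function \<open>G\<close> assigning a set of
  strategies to each player; componentwise inclusion and intersection are the library's pointwise
  \<open>\<le>\<close> and \<open>INF\<close> on functions into sets.
\<close>

type_synonym ('i, 's) restriction = "'i \<Rightarrow> 's set"
type_synonym ('i, 's) payoffs = "'i \<Rightarrow> ('i \<Rightarrow> 's) \<Rightarrow> real"
type_synonym ('i, 's) property = "'i \<Rightarrow> 's \<Rightarrow> ('i, 's) restriction \<Rightarrow> bool"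

text \<open>
  An element \<open>t\<close> of \<open>opponents i G\<close> is undefined at \<open>i\<close>; the joint strategy consisting of \<open>s\<close> for
  player \<open>i\<close> and \<open>t\<close> for the opponents is \<open>t(i := s)\<close>.
\<close>

definition opponents :: "'i \<Rightarrow> ('i, 's) restriction \<Rightarrow> ('i \<Rightarrow> 's) set" where
  "opponents i G = (\<Pi>\<^sub>E j\<in>UNIV - {i}. G j)"

definition br_global :: "('i, 's) restriction \<Rightarrow> ('i, 's) payoffs \<Rightarrow> ('i, 's) property" where
  "br_global H p i s G \<longleftrightarrow>
     (\<exists>t\<in>opponents i G. \<forall>s'\<in>H i. p i (t(i := s)) \<ge> p i (t(i := s')))"

definition sd_local :: "('i, 's) payoffs \<Rightarrow> ('i, 's) property" where
  "sd_local p i s G \<longleftrightarrow>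
     \<not> (\<exists>s'\<in>G i. \<forall>t\<in>opponents i G. p i (t(i := s')) > p i (t(i := s)))"

definition T_op :: "('i, 's) property \<Rightarrow> ('i, 's) restriction \<Rightarrow> ('i, 's) restriction" where
  "T_op \<phi> G = (\<lambda>i. {s \<in> G i. \<phi> i s G})"


section \<open>Transfinite iteration\<close>

text \<open>
  Ordinals are represented by the elements of the field of a well-order \<open>r\<close>: the element \<open>\<alpha>\<close>
  stands for the order type of \<open>underS r \<alpha>\<close>. Thus \<open>\<alpha>\<close> is zero if \<open>underS r \<alpha> = {}\<close>, it is the
  successor of \<open>\<beta>\<close> if \<open>\<beta>\<close> is the largest element of \<open>underS r \<alpha>\<close>, and a limit otherwise.
\<close>

definition is_succ_of :: "'o rel \<Rightarrow> 'o \<Rightarrow> 'o \<Rightarrow> bool" where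
  "is_succ_of r \<alpha> \<beta> \<longleftrightarrow> \<beta> \<in> underS r \<alpha> \<and> (\<forall>\<gamma>\<in>underS r \<alpha>. (\<gamma>, \<beta>) \<in> r)"

definition iterate_step ::
  "'o rel \<Rightarrow> ('a \<Rightarrow> 'a) \<Rightarrow> 'a \<Rightarrow> ('o \<Rightarrow> 'a) \<Rightarrow> 'o \<Rightarrow> 'a::complete_lattice" where
  "iterate_step r T H X \<alpha> =
     (if underS r \<alpha> = {} then H
      else if \<exists>\<beta>. is_succ_of r \<alpha> \<beta> then T (X (THE \<beta>. is_succ_of r \<alpha> \<beta>))
      else (INF \<beta>\<in>underS r \<alpha>. X \<beta>))"

definition iterate :: "'o rel \<Rightarrow> ('a \<Rightarrow> 'a) \<Rightarrow> 'a \<Rightarrow> 'o \<Rightarrow> 'a::complete_lattice" where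
  "iterate r T H = wo_rel.worec r (iterate_step r T H)"

text \<open>
  The iteration on \<open>'a\<close> is run along the successor cardinal of the cardinality of \<open>'a\<close>. A
  decreasing iteration stabilises below this ordinal (lemma \<open>closure_ordinal_exists\<close>), so the
  least \<open>\<alpha>\<close> with \<open>T\<^bsup>\<alpha>+1\<^esup> = T\<^bsup>\<alpha>\<^esup>\<close> among all ordinals is found there.
\<close>

abbreviation ordinals :: "'a itself \<Rightarrow> 'a set rel" where
  "ordinals _ \<equiv> cardSuc |UNIV :: 'a set|"

definition closure_ordinal :: "('a \<Rightarrow> 'a) \<Rightarrow> 'a \<Rightarrow> 'a::complete_lattice set" where
  "closure_ordinal T H =
     (let r = ordinals TYPE('a)
      in wo_rel.minim r {\<alpha> \<in> Field r. T (iterate r T H \<alpha>) = iterate r T H \<alpha>})"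

definition T_infinity :: "('a \<Rightarrow> 'a) \<Rightarrow> 'a \<Rightarrow> 'a::complete_lattice" where
  "T_infinity T H = iterate (ordinals TYPE('a)) T H (closure_ordinal T H)"

lemma is_succ_of_unique:
  assumes "Well_order r" "is_succ_of r \<alpha> \<beta>" "is_succ_of r \<alpha> \<gamma>"
  shows "\<beta> = \<gamma>"
  using wo_rel.ANTISYM[of r] assms
  unfolding is_succ_of_def wo_rel_def antisym_def by blast

lemma the_succ_of:
  assumes "Well_order r" "is_succ_of r \<alpha> \<beta>"
  shows "(THE \<beta>. is_succ_of r \<alpha> \<beta>) = \<beta>"
  using assms is_succ_of_unique by (metis the_equality)

lemma iterate_unfold:
  fixes r :: "'o rel" and T :: "'a::complete_lattice \<Rightarrow> 'a"
  assumes "Well_order r"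
  shows "iterate r T H \<alpha> = iterate_step r T H (iterate r T H) \<alpha>"
proof -
  have wo: "wo_rel r"
    using assms by (simp add: wo_rel_def)
  have "wo_rel.adm_wo r (iterate_step r T H)"
    unfolding wo_rel.adm_wo_def[OF wo]
  proof (intro allI impI)
    fix X Y :: "'o \<Rightarrow> 'a" and \<alpha>
    assume eq: "\<forall>\<beta>\<in>underS r \<alpha>. X \<beta> = Y \<beta>"
    have "X (THE \<beta>. is_succ_of r \<alpha> \<beta>) = Y (THE \<beta>. is_succ_of r \<alpha> \<beta>)"
      if "is_succ_of r \<alpha> \<beta>" for \<beta>
      using the_succ_of[OF assms that] that eq by (simp add: is_succ_of_def)
    moreover have "(INF \<beta>\<in>underS r \<alpha>. X \<beta>) = (INF \<beta>\<in>underS r \<alpha>. Y \<beta>)"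
      using eq by (intro INF_cong) auto
    ultimately show "iterate_step r T H X \<alpha> = iterate_step r T H Y \<alpha>"
      unfolding iterate_step_def by auto
  qed
  from wo_rel.worec_fixpoint[OF wo this] show ?thesis
    unfolding iterate_def by (rule fun_cong)
qed

lemma iterate_zero:
  assumes "Well_order r" "underS r \<alpha> = {}"
  shows "iterate r T H \<alpha> = H"
  by (subst iterate_unfold) (use assms in \<open>simp_all add: iterate_step_def\<close>)

lemma iterate_succ:
  assumes "Well_order r" "is_succ_of r \<alpha> \<beta>"
  shows "iterate r T H \<alpha> = T (iterate r T H \<beta>)"
proof -
  have "underS r \<alpha> \<noteq> {}"
    using assms(2) by (auto simp: is_succ_of_def)
  then show ?thesis
    using assms the_succ_of[OF assms]
    by (subst iterate_unfold) (auto simp: iterate_step_def)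
qed

lemma iterate_limit:
  assumes "Well_order r" "underS r \<alpha> \<noteq> {}" "\<nexists>\<beta>. is_succ_of r \<alpha> \<beta>"
  shows "iterate r T H \<alpha> = (INF \<beta>\<in>underS r \<alpha>. iterate r T H \<beta>)"
  unfolding iterate_unfold[OF assms(1), of T H \<alpha>] iterate_step_def
  using assms(2,3) by (simp only: if_False)

lemma iterate_decreasing:
  fixes T :: "'a::complete_lattice \<Rightarrow> 'a"
  assumes wo: "Well_order r" and T: "\<And>x. T x \<le> x"
  shows "\<beta> \<in> underS r \<alpha> \<Longrightarrow> iterate r T H \<alpha> \<le> iterate r T H \<beta>"
proof (induction \<alpha> arbitrary: \<beta> rule: wo_rel.well_order_induct[of r])
  case 1
  then show ?case using wo by (simp add: wo_rel_def)
next
  case (2 \<alpha>)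
  show ?case
  proof (cases "\<exists>\<gamma>. is_succ_of r \<alpha> \<gamma>")
    case True
    then obtain \<gamma> where \<gamma>: "is_succ_of r \<alpha> \<gamma>" by blast
    then have "\<gamma> \<noteq> \<alpha>" "(\<gamma>, \<alpha>) \<in> r" and "(\<beta>, \<gamma>) \<in> r"
      using 2(2) by (auto simp: is_succ_of_def underS_def)
    then have "iterate r T H \<gamma> \<le> iterate r T H \<beta>"
      using 2(1) by (cases "\<beta> = \<gamma>") (auto simp: underS_def)
    then show ?thesis
      using iterate_succ[OF wo \<gamma>, of T H] T[of "iterate r T H \<gamma>"] by simp
  next
    case False
    then show ?thesis
      using iterate_limit[OF wo _ False, of T H] 2(2) INF_lower[of \<beta> "underS r \<alpha>" "iterate r T H"]
      by (metis empty_iff)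
  qed
qed

lemma Well_order_ordinals: "Well_order (ordinals TYPE('a))"
  using cardSuc_Card_order[OF card_of_Card_order, of "UNIV :: 'a set"]
  by (simp add: card_order_on_def)

lemma closure_ordinal_exists:
  fixes T :: "'a::complete_lattice \<Rightarrow> 'a"
  assumes T: "\<And>x. T x \<le> x"
  shows "\<exists>\<alpha>\<in>Field (ordinals TYPE('a)).
           T (iterate (ordinals TYPE('a)) T H \<alpha>) = iterate (ordinals TYPE('a)) T H \<alpha>"
proof (rule ccontr)
  let ?r = "ordinals TYPE('a)" and ?X = "iterate (ordinals TYPE('a)) T H"
  assume none: "\<not> ?thesis"
  note wo = Well_order_ordinals[where ?'a = 'a]
  have wor: "wo_rel ?r" using wo by (simp add: wo_rel_def)
  have neq: "?X \<alpha> \<noteq> ?X \<beta>" if "\<beta> \<in> underS ?r \<alpha>" for \<alpha> \<beta>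
  proof -
    have "\<beta> \<in> Field ?r" using that by (auto simp: underS_def Field_def)
    with none have lt: "T (?X \<beta>) \<noteq> ?X \<beta>" by blast
    have "AboveS ?r {\<beta>} \<noteq> {}"
      using that by (auto simp: AboveS_def underS_def Field_def)
    then have s: "\<beta> \<in> underS ?r (wo_rel.suc ?r {\<beta>})" "(wo_rel.suc ?r {\<beta>}, \<alpha>) \<in> ?r"
      and F: "wo_rel.suc ?r {\<beta>} \<in> Field ?r"
      using wo_rel.suc_greater[OF wor, of "{\<beta>}" \<beta>] wo_rel.suc_least_AboveS[OF wor, of \<alpha> "{\<beta>}"]
        wo_rel.suc_inField[OF wor, of "{\<beta>}"] that \<open>\<beta> \<in> Field ?r\<close>
      by (auto simp: AboveS_def underS_def Field_def)
    have "is_succ_of ?r (wo_rel.suc ?r {\<beta>}) \<beta>"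
      unfolding is_succ_of_def
    proof (intro conjI s ballI)
      fix \<gamma> assume \<gamma>: "\<gamma> \<in> underS ?r (wo_rel.suc ?r {\<beta>})"
      show "(\<gamma>, \<beta>) \<in> ?r"
      proof (rule ccontr)
        assume n: "(\<gamma>, \<beta>) \<notin> ?r"
        have "\<gamma> \<in> Field ?r" using \<gamma> by (auto simp: underS_def Field_def)
        then have "(\<beta>, \<gamma>) \<in> ?r" "\<gamma> \<noteq> \<beta>"
          using n wo_rel.TOTALS[OF wor] \<open>\<beta> \<in> Field ?r\<close> by blast+
        then have "\<gamma> \<in> AboveS ?r {\<beta>}"
          using \<open>\<gamma> \<in> Field ?r\<close> by (auto simp: AboveS_def)
        then have "(wo_rel.suc ?r {\<beta>}, \<gamma>) \<in> ?r"
          by (rule wo_rel.suc_least_AboveS[OF wor])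
        then show False
          using \<gamma> wo_rel.ANTISYM[OF wor] unfolding antisym_def underS_def by blast
      qed
    qed
    then have "?X (wo_rel.suc ?r {\<beta>}) = T (?X \<beta>)"
      by (rule iterate_succ[OF wo])
    moreover have "?X \<alpha> \<le> ?X (wo_rel.suc ?r {\<beta>})"
      using s(2) iterate_decreasing[OF wo T, of "wo_rel.suc ?r {\<beta>}" \<alpha> H]
      by (cases "\<alpha> = wo_rel.suc ?r {\<beta>}") (auto simp: underS_def)
    ultimately show ?thesis
      using lt T[of "?X \<beta>"] by auto
  qed
  have "inj_on ?X (Field ?r)"
  proof (rule inj_onI, rule ccontr)
    fix \<alpha> \<beta> assume "\<alpha> \<in> Field ?r" "\<beta> \<in> Field ?r" and eq: "?X \<alpha> = ?X \<beta>" and "\<alpha> \<noteq> \<beta>"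
    then have "\<alpha> \<in> underS ?r \<beta> \<or> \<beta> \<in> underS ?r \<alpha>"
      using wo_rel.TOTALS[OF wor] by (auto simp: underS_def)
    with neq eq show False by metis
  qed
  then have "|Field ?r| \<le>o |UNIV :: 'a set|"
    by (intro card_of_ordLeqI) auto
  moreover have "|UNIV :: 'a set| <o |Field ?r|"
    using cardSuc_greater[OF card_of_Card_order, of "UNIV :: 'a set"]
      card_of_Field_ordIso[OF cardSuc_Card_order[OF card_of_Card_order, of "UNIV :: 'a set"]]
    by (meson ordIso_symmetric ordLess_ordIso_trans)
  ultimately show False
    using not_ordLess_ordLeq by blast
qed

lemma closure_ordinal:
  fixes T :: "'a::complete_lattice \<Rightarrow> 'a"
  assumes T: "\<And>x. T x \<le> x"
  shows "closure_ordinal T H \<in> Field (ordinals TYPE('a))"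
    and "T (T_infinity T H) = T_infinity T H"
proof -
  let ?r = "ordinals TYPE('a)"
  let ?A = "{\<alpha> \<in> Field ?r. T (iterate ?r T H \<alpha>) = iterate ?r T H \<alpha>}"
  have wor: "wo_rel ?r" using Well_order_ordinals by (simp add: wo_rel_def)
  have "?A \<noteq> {}" using closure_ordinal_exists[OF T] by auto
  then have "wo_rel.minim ?r ?A \<in> ?A"
    by (intro wo_rel.minim_in[OF wor]) auto
  then show "closure_ordinal T H \<in> Field ?r" "T (T_infinity T H) = T_infinity T H"
    unfolding T_infinity_def closure_ordinal_def Let_def by auto
qed


section \<open>Belief and knowledge models\<close>

locale belief_model =
  fixes H :: "('i, 's) restriction"
    and \<Omega> :: "'w set"
    and s :: "'i \<Rightarrow> 'w \<Rightarrow> 's"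
    and P :: "'i \<Rightarrow> 'w \<Rightarrow> 'w set"
  assumes states_nonempty: "\<Omega> \<noteq> {}"
    and strategy: "\<omega> \<in> \<Omega> \<Longrightarrow> s i \<omega> \<in> H i"
    and P_subset: "\<omega> \<in> \<Omega> \<Longrightarrow> P i \<omega> \<subseteq> \<Omega>"
    and P_nonempty: "\<omega> \<in> \<Omega> \<Longrightarrow> P i \<omega> \<noteq> {}"
    and P_eq: "\<omega> \<in> \<Omega> \<Longrightarrow> \<omega>' \<in> P i \<omega> \<Longrightarrow> P i \<omega>' = P i \<omega>"

locale knowledge_model = belief_model +
  assumes P_refl: "\<omega> \<in> \<Omega> \<Longrightarrow> \<omega> \<in> P i \<omega>"

definition box :: "'w set \<Rightarrow> ('i \<Rightarrow> 'w \<Rightarrow> 'w set) \<Rightarrow> 'w set \<Rightarrow> 'w set" where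
  "box \<Omega> P E = {\<omega> \<in> \<Omega>. \<forall>i. P i \<omega> \<subseteq> E}"

text \<open>\<open>box_star\<close> is written \<open>B\<^sup>*\<close> in belief models and \<open>K\<^sup>*\<close> in knowledge models.\<close>

definition box_star :: "'w set \<Rightarrow> ('i \<Rightarrow> 'w \<Rightarrow> 'w set) \<Rightarrow> 'w set \<Rightarrow> 'w set" where
  "box_star \<Omega> P E = (\<Inter>k\<in>{1..}. (box \<Omega> P ^^ k) E)"

definition restriction_of :: "('i \<Rightarrow> 'w \<Rightarrow> 's) \<Rightarrow> 'w set \<Rightarrow> ('i, 's) restriction" where
  "restriction_of s E = (\<lambda>i. s i ` E)"

definition RAT ::
  "'w set \<Rightarrow> ('i \<Rightarrow> 'w \<Rightarrow> 's) \<Rightarrow> ('i \<Rightarrow> 'w \<Rightarrow> 'w set) \<Rightarrow> ('i, 's) property \<Rightarrow> 'w set" where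
  "RAT \<Omega> s P \<phi> = {\<omega> \<in> \<Omega>. \<forall>i. \<phi> i (s i \<omega>) (restriction_of s (P i \<omega>))}"

end

theory Submission
  imports Defs
begin

text \<open>
  The states in which rationality holds and is commonly believed form an evident event: each
  player's beliefs in such a state lie inside the event again. So every strategy played in the event
  is a global best response to a profile \<open>t\<close> that is itself played in the event. As long as an
  iterate of the elimination operator contains the strategies played in the event, it contains
  \<open>t\<close>, and \<open>t\<close> witnesses that the strategy is not strictly dominated in that iterate. By
  transfinite induction these strategies are never eliminated.
\<close>

text \<open>The operator of \<open>sd_local\<close> is not monotone in general, so the induction
  rests on an order interval that \<open>T\<close> maps into itself. The upper bound
  \<open>H\<close> is carried along because undominatedness in an iterate is derived only for
  iterates below \<open>H\<close>.\<close>

lemma iterate_between: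
  fixes T :: "'a::complete_lattice \<Rightarrow> 'a"
  assumes wo: "Well_order r" and "L \<le> H"
    and T: "\<And>x. L \<le> x \<Longrightarrow> x \<le> H \<Longrightarrow> L \<le> T x \<and> T x \<le> H"
  shows "L \<le> iterate r T H \<alpha> \<and> iterate r T H \<alpha> \<le> H"
proof (induction \<alpha> rule: wo_rel.well_order_induct[of r])
  case 1
  then show ?case using wo by (simp add: wo_rel_def)
next
  case (2 \<alpha>)
  then have IH: "L \<le> iterate r T H \<beta> \<and> iterate r T H \<beta> \<le> H" if "\<beta> \<in> underS r \<alpha>" for \<beta>
    using that by (auto simp: underS_def)
  consider "underS r \<alpha> = {}" | \<beta> where "is_succ_of r \<alpha> \<beta>"
    | "underS r \<alpha> \<noteq> {}" "\<nexists>\<beta>. is_succ_of r \<alpha> \<beta>"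
    by blast
  then show ?case
  proof cases
    case 1
    then show ?thesis using iterate_zero[OF wo 1, of T H] \<open>L \<le> H\<close> by simp
  next
    case (2 \<beta>)
    then have "\<beta> \<in> underS r \<alpha>" by (simp add: is_succ_of_def)
    then show ?thesis using iterate_succ[OF wo 2, of T H] T IH by simp
  next
    case 3
    \<comment> \<open>The upper bound needs an index: an infimum over no indices would be the top
      element.\<close>
    then obtain \<beta> where "\<beta> \<in> underS r \<alpha>" by blast
    then have "(INF \<beta>\<in>underS r \<alpha>. iterate r T H \<beta>) \<le> H"
      using IH by (blast intro: INF_lower2)
    moreover have "L \<le> (INF \<beta>\<in>underS r \<alpha>. iterate r T H \<beta>)"
      using IH by (blast intro: INF_greatest)
    ultimately show ?thesis using iterate_limit[OF wo 3, of T H] by simp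
  qed
qed

lemma opponents_mono:
  assumes "G \<le> G'"
  shows "opponents i G \<subseteq> opponents i G'"
  using assms unfolding opponents_def by (auto simp: le_fun_def intro!: PiE_mono)

lemma restriction_of_mono:
  assumes "E \<subseteq> F"
  shows "restriction_of s E \<le> restriction_of s F"
  using assms by (auto simp: restriction_of_def le_fun_def)

text \<open>\<open>G\<close> enters only as the range of the witness \<open>t\<close>; the competing
  strategies always come from \<open>H i\<close>.\<close>

lemma br_global_mono:
  assumes "br_global H p i x G" "G \<le> G'"
  shows "br_global H p i x G'"
  using assms opponents_mono[of G G' i] unfolding br_global_def by blast

text \<open>A dominating strategy from \<open>G i\<close> would lie in \<open>H i\<close> and do
  strictly better against the witness \<open>t\<close> too.\<close>

lemma br_global_imp_sd_local:
  assumes "br_global H p i x G" "G \<le> H"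
  shows "sd_local p i x G"
  using assms unfolding br_global_def sd_local_def le_fun_def by (meson not_le subsetD)

lemma le_T_infinity_sd_local:
  assumes "G \<le> H" and br: "\<And>i x. x \<in> G i \<Longrightarrow> br_global H p i x G"
  shows "G \<le> T_infinity (T_op (sd_local p)) H"
proof -
  have "G \<le> T_op (sd_local p) X \<and> T_op (sd_local p) X \<le> H" if "G \<le> X" "X \<le> H" for X
  proof
    \<comment> \<open>The best response property is lifted to \<open>X\<close> before it is turned
      into undominatedness: \<open>sd_local\<close> itself may fail to pass from \<open>G\<close> to
      \<open>X\<close>, since \<open>X\<close> can offer new dominating strategies.\<close>
    show "G \<le> T_op (sd_local p) X"
      using br_global_imp_sd_local[OF br_global_mono[OF br \<open>G \<le> X\<close>] \<open>X \<le> H\<close>] \<open>G \<le> X\<close>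
      by (auto simp: T_op_def le_fun_def)
    show "T_op (sd_local p) X \<le> H"
      using \<open>X \<le> H\<close> by (auto simp: T_op_def le_fun_def)
  qed
  with iterate_between[OF Well_order_ordinals \<open>G \<le> H\<close>] show ?thesis
    unfolding T_infinity_def by blast
qed

text \<open>Shifting the index by one: lying in power \<open>Suc k\<close> of \<open>box\<close>
  puts the beliefs inside power \<open>k\<close>. Power 0 gives \<open>E\<close>, the others give
  \<open>box_star\<close>.\<close>

lemma P_subset_if_box_star:
  assumes "\<omega> \<in> box_star \<Omega> P E"
  shows "P i \<omega> \<subseteq> E \<inter> box_star \<Omega> P E"
proof -
  have pow: "P i \<omega> \<subseteq> (box \<Omega> P ^^ k) E" for k
  proof -
    have "\<omega> \<in> (box \<Omega> P ^^ Suc k) E"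
      using assms unfolding box_star_def by (rule INT_D) simp
    then show ?thesis by (auto simp: box_def)
  qed
  have "P i \<omega> \<subseteq> E" using pow[of 0] by simp
  moreover have "P i \<omega> \<subseteq> box_star \<Omega> P E" unfolding box_star_def using pow by blast
  ultimately show ?thesis by blast
qed

lemma (in belief_model) restriction_of_RAT_le:
  "restriction_of s (RAT \<Omega> s P (br_global H p) \<inter> box_star \<Omega> P (RAT \<Omega> s P (br_global H p)))
     \<le> T_infinity (T_op (sd_local p)) H"
proof -
  define R where "R = RAT \<Omega> s P (br_global H p)"
  have "restriction_of s (R \<inter> box_star \<Omega> P R) \<le> T_infinity (T_op (sd_local p)) H"
  proof (rule le_T_infinity_sd_local)
    show "restriction_of s (R \<inter> box_star \<Omega> P R) \<le> H"
      using strategy by (auto simp: restriction_of_def le_fun_def R_def RAT_def)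
  next
    fix i x
    assume "x \<in> restriction_of s (R \<inter> box_star \<Omega> P R) i"
    then obtain \<omega> where \<omega>: "\<omega> \<in> R" "\<omega> \<in> box_star \<Omega> P R" and x: "x = s i \<omega>"
      by (auto simp: restriction_of_def)
    have "br_global H p i x (restriction_of s (P i \<omega>))"
      using \<omega>(1) x by (simp add: R_def RAT_def)
    then show "br_global H p i x (restriction_of s (R \<inter> box_star \<Omega> P R))"
      by (rule br_global_mono) (rule restriction_of_mono[OF P_subset_if_box_star[OF \<omega>(2)]])
  qed
  then show ?thesis unfolding R_def .
qed

lemma (in knowledge_model) box_star_subset: "box_star \<Omega> P E \<subseteq> E"
proof
  fix \<omega> assume \<omega>: "\<omega> \<in> box_star \<Omega> P E"
  \<comment> \<open>The first power places the state in \<Omega>, where reflexivity is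
    available.\<close>
  then have "\<omega> \<in> (box \<Omega> P ^^ 1) E"
    unfolding box_star_def by (rule INT_D) simp
  then have "\<omega> \<in> \<Omega>" by (simp add: box_def)
  then show "\<omega> \<in> E" using P_refl P_subset_if_box_star[OF \<omega>] by blast
qed

theorem theorem3:
  fixes H :: "('i::finite, 's) restriction"
    and p :: "('i, 's) payoffs"
  assumes "CARD('i) > 1"
    and "\<And>i. H i \<noteq> {}"
  shows "(\<forall>(\<Omega> :: 'w set) s P. belief_model H \<Omega> s P \<longrightarrow>
            restriction_of s
              (RAT \<Omega> s P (br_global H p) \<inter> box_star \<Omega> P (RAT \<Omega> s P (br_global H p)))
            \<le> T_infinity (T_op (sd_local p)) H)
       \<and> (\<forall>(\<Omega> :: 'w set) s P. knowledge_model H \<Omega> s P \<longrightarrow>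
            restriction_of s (box_star \<Omega> P (RAT \<Omega> s P (br_global H p)))
            \<le> T_infinity (T_op (sd_local p)) H)"
proof (intro conjI allI impI)
  fix \<Omega> :: "'w set" and s P
  assume "belief_model H \<Omega> s P"
  then show "restriction_of s
      (RAT \<Omega> s P (br_global H p) \<inter> box_star \<Omega> P (RAT \<Omega> s P (br_global H p)))
      \<le> T_infinity (T_op (sd_local p)) H"
    by (rule belief_model.restriction_of_RAT_le)
next
  fix \<Omega> :: "'w set" and s P
  assume "knowledge_model H \<Omega> s P"
  then interpret knowledge_model H \<Omega> s P .
  show "restriction_of s (box_star \<Omega> P (RAT \<Omega> s P (br_global H p)))
      \<le> T_infinity (T_op (sd_local p)) H"
    \<comment> \<open>Common knowledge of rationality implies rationality, so the intersection in
      the belief version collapses.\<close>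
    using restriction_of_RAT_le[of p] box_star_subset by (simp add: Int_absorb1)
qed

end
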